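(* Let $n\ge1$. Replacing each word $\underline{a}$ of the list $G_n$ by the standard permutation $\pi(\underline{a})$ yields a list in which every standard permutation of $\{\pm1,\ldots,\pm n\}$ appears exactly once and any two consecutive permutations differ by an adjacent transposition; i.e. it is an adjacent transposition Gray code for the standard permutations of $\{\pm1,\ldots,\pm n\}$.
   Context: A standard permutation of $\{\pm1,\ldots,\pm n\}$ is a word in which each element of $\{\pm1,\ldots,\pm n\}$ appears exactly once, such that for every $i$, $i$ occurs before $-i$, and the negative entries occur in the order $-1,\ldots,-n$. For a word $a_1\cdots a_n$ with $1\le a_i\le 2i-1$, $\pi(a_1\cdots a_n)$ is defined recursively: $\pi(a_1)=(1,-1)$, and for $n\ge2$, $\pi(a_1\cdots a_n)$ is obtained from $\pi(a_1\cdots a_{n-1})$ (length $2n-2$) by inserting the letter $n$ so that it occupies position $a_n$ and then appending $-n$ at the end. The list $G_n$ of words is defined recursively: $G_1=(1)$; for $n\ge2$, if $G_{n-1}=(w_1,\ldots,w_N)$, then $G_n$ is the concatenation over $m=1,\ldots,N$ of the blocks $(w_m1,w_m2,\ldots,w_m(2n-1))$ for $m$ odd and $(w_m(2n-1),\ldots,w_m2,w_m1)$ for $m$ even, where $w_mx$ denotes $w_m$ with the letter $x$ appended. Two words of length $2n$ differ by an adjacent transposition if one is obtained from the other by exchanging the entries in positions $i$ and $i+1$ for some $i$, all other entries unchanged. *)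

theory Defs
  imports Main
begin

definition occurs_before :: "'a list \<Rightarrow> 'a \<Rightarrow> 'a \<Rightarrow> bool" where
  "occurs_before w x y \<longleftrightarrow> (\<exists>p q. p < q \<and> q < length w \<and> w ! p = x \<and> w ! q = y)"

definition standard_permutation :: "nat \<Rightarrow> int list \<Rightarrow> bool" where
  "standard_permutation n w \<longleftrightarrow>
     distinct w \<and> set w = {1..int n} \<union> {- int n..-1} \<and>
     (\<forall>i\<in>{1..int n}. occurs_before w i (- i)) \<and>
     filter (\<lambda>x. x < 0) w = map (\<lambda>i. - int i) [1..<Suc n]"

(* Positions are counted from 1. *)
definition insert_at :: "nat \<Rightarrow> 'a \<Rightarrow> 'a list \<Rightarrow> 'a list" where
  "insert_at p x ys = take (p - 1) ys @ x # drop (p - 1) ys"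

(* The map pi from words to standard permutations, by recursion on the last letter.
   Only nonempty words are meaningful; the value at the empty word is a dummy. *)
function perm_of_word :: "nat list \<Rightarrow> int list" where
  "perm_of_word a =
     (if length a = 0 then []
      else if length a = 1 then [1, -1]
      else insert_at (last a) (int (length a)) (perm_of_word (butlast a)) @ [- int (length a)])"
  by pat_completeness auto
termination
  by (relation "measure length") auto

declare perm_of_word.simps [simp del]

(* The list G_n, meaningful for n >= 1; the value at 0 is a dummy.
   The blocks are numbered from m = 1, so block m extends the list entry of index m - 1. *)
fun gray_words :: "nat \<Rightarrow> nat list list" where
  "gray_words 0 = []"
| "gray_words (Suc 0) = [[1]]"
| "gray_words (Suc (Suc k)) =
     (let n = Suc (Suc k); ws = gray_words (Suc k) in
        concat (map (\<lambda>m. map (\<lambda>x. ws ! (m - 1) @ [x])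
                           (if odd m then [1..<2 * n] else rev [1..<2 * n]))
                    [1..<Suc (length ws)]))"

definition differ_by_adjacent_transposition :: "'a list \<Rightarrow> 'a list \<Rightarrow> bool" where
  "differ_by_adjacent_transposition u v \<longleftrightarrow>
     (\<exists>i. Suc i < length u \<and> v = u[i := u ! Suc i, Suc i := u ! i])"

definition adjacent_transposition_gray_code :: "'a list set \<Rightarrow> 'a list list \<Rightarrow> bool" where
  "adjacent_transposition_gray_code S L \<longleftrightarrow>
     set L = S \<and> distinct L \<and>
     (\<forall>j. Suc j < length L \<longrightarrow> differ_by_adjacent_transposition (L ! j) (L ! Suc j))"

end

theory Submission
  imports Defs "HOL-Library.Sublist"
begin

text \<open>A standard permutation of order \<open>n \<ge> 2\<close> ends in \<open>-n\<close>, and deleting \<open>n\<close> and \<open>-n\<close> leaves a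
  standard permutation of order \<open>n - 1\<close>; conversely \<open>n\<close> may be inserted at any of the \<open>2n - 1\<close>
  positions. So the list arises from its predecessor by letting \<open>n\<close> sweep through every permutation,
  alternately from left to right and from right to left. Moving \<open>n\<close> by one position is an adjacent
  transposition, and between two sweeps \<open>n\<close> rests at one end of the word, where an adjacent
  transposition of the shorter permutation remains one after the insertion.\<close>

section \<open>Boustrophedon products of lists\<close>

lemma successively_iff_nth:
  "successively R xs \<longleftrightarrow> (\<forall>j. Suc j < length xs \<longrightarrow> R (xs ! j) (xs ! Suc j))"
proof (induction R xs rule: successively.induct)
  case (3 R x y xs)
  then show ?case by (auto simp: nth_Cons split: nat.splits)
qed auto

text \<open>The flag carries the direction of the next block, so inductions over \<open>ws\<close>
  need no index parity. Abstract \<open>f\<close> covers both appending a letter to a word and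
  extending a permutation.\<close>

fun boustrophedon :: "('a \<Rightarrow> 'b \<Rightarrow> 'c) \<Rightarrow> 'b list \<Rightarrow> bool \<Rightarrow> 'a list \<Rightarrow> 'c list" where
  "boustrophedon f xs b [] = []"
| "boustrophedon f xs b (w # ws) =
     map (f w) (if b then xs else rev xs) @ boustrophedon f xs (\<not> b) ws"

text \<open>The free start index \<open>k\<close> makes the induction possible: dropping the first
  block shifts it to \<open>Suc k\<close> and so flips the parity. \<open>gray_words\<close> uses
  \<open>k = 1\<close>.\<close>

lemma concat_map_parity_eq_boustrophedon:
  "concat (map (\<lambda>m. map (f (ws ! (m - k))) (if odd m then xs else rev xs)) [k..<k + length ws])
     = boustrophedon f xs (odd k) ws"
proof (induction ws arbitrary: k)
  case Nil
  then show ?case by simp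
next
  case (Cons w ws)
  have "map (\<lambda>m. map (f ((w # ws) ! (m - k))) (if odd m then xs else rev xs))
          [Suc k..<Suc k + length ws] =
        map (\<lambda>m. map (f (ws ! (m - Suc k))) (if odd m then xs else rev xs))
          [Suc k..<Suc k + length ws]"
    by (rule map_cong) (auto simp: nth_Cons')
  moreover have "[k..<k + length (w # ws)] = k # [Suc k..<Suc k + length ws]"
    by (simp add: upt_conv_Cons del: upt_Suc)
  ultimately show ?case
    using Cons.IH[of "Suc k"] by (simp del: upt_Suc map_eq_conv)
qed

text \<open>With \<open>g\<close> and \<open>h\<close> both \<open>perm_of_word\<close>, this
  carries the recursion for words over to one for permutations.\<close>

lemma map_boustrophedon:
  assumes "\<And>w x. w \<in> set ws \<Longrightarrow> g (f w x) = f' (h w) x"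
  shows "map g (boustrophedon f xs b ws) = boustrophedon f' xs b (map h ws)"
  using assms by (induction ws arbitrary: b) auto

lemma set_boustrophedon:
  "set (boustrophedon f xs b ws) = (\<Union>w\<in>set ws. f w ` set xs)"
  by (induction ws arbitrary: b) auto

lemma distinct_boustrophedon:
  assumes "distinct ws" "distinct xs" "inj_on (\<lambda>(w, x). f w x) (set ws \<times> set xs)"
  shows "distinct (boustrophedon f xs b ws)"
  using assms
proof (induction ws arbitrary: b)
  case Nil
  then show ?case by simp
next
  case (Cons w ws)
  have inj: "f u x = f v y \<Longrightarrow> u = v \<and> x = y"
    if "u \<in> set (w # ws)" "v \<in> set (w # ws)" "x \<in> set xs" "y \<in> set xs" for u v x y
    using inj_onD[OF Cons.prems(3), of "(u, x)" "(v, y)"] that by auto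
  have "inj_on (f w) (set xs)"
    using inj[of w w] by (auto intro: inj_onI)
  moreover have "f w ` set xs \<inter> (\<Union>v\<in>set ws. f v ` set xs) = {}"
    using inj[of w] Cons.prems(1) by fastforce
  moreover have "distinct (boustrophedon f xs (\<not> b) ws)"
    using Cons.prems by (intro Cons.IH) (auto elim: inj_on_subset)
  ultimately show ?case
    using Cons.prems by (auto simp: distinct_map set_boustrophedon)
qed

text \<open>Since the direction flips, two neighbouring blocks meet at the same letter
  \<open>x\<close>, an end of \<open>xs\<close>. Only there must \<open>S\<close> on the outer list
  yield \<open>R\<close>.\<close>

lemma successively_boustrophedon:
  assumes "symp R" "xs \<noteq> []" "successively S ws"
    and "\<And>w. w \<in> set ws \<Longrightarrow> successively R (map (f w) xs)"
    and "\<And>u v x. S u v \<Longrightarrow> u \<in> set ws \<Longrightarrow> v \<in> set ws \<Longrightarrow> x \<in> {hd xs, last xs} \<Longrightarrow> R (f u x) (f v x)"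
  shows "successively R (boustrophedon f xs b ws)"
  using assms(3-)
proof (induction ws arbitrary: b)
  case Nil
  then show ?case by simp
next
  case (Cons w ws)
  \<comment> \<open>Symmetry of \<open>R\<close> lets a block be traversed backwards.\<close>
  have "successively R (rev (map (f w) xs))"
    unfolding successively_rev
    by (rule successively_mono[OF Cons.prems(2)]) (auto intro: sympD[OF assms(1)])
  hence block: "successively R (map (f w) (if b then xs else rev xs))"
    using Cons.prems(2)[of w] by (simp add: rev_map)
  have rest: "successively R (boustrophedon f xs (\<not> b) ws)"
    using Cons.prems by (intro Cons.IH) (auto simp: successively_Cons)
  show ?case
  proof (cases ws)
    case Nil
    then show ?thesis using block by simp
  next
    case (Cons v vs)
    hence "S w v" using Cons.prems by (simp add: successively_Cons)
    hence "R (f w x) (f v x)" if "x \<in> {hd xs, last xs}" for x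
      using Cons.prems(3) Cons that by simp
    then show ?thesis
      using block rest assms(2) Cons
      by (auto simp: successively_append_iff last_map hd_map hd_rev last_rev)
  qed
qed

section \<open>Adjacent transpositions\<close>

text \<open>Free of indices, this form makes symmetry and stability under added context
  immediate.\<close>

lemma differ_by_adjacent_transposition_iff:
  "differ_by_adjacent_transposition u v
     \<longleftrightarrow> (\<exists>as x y bs. u = as @ x # y # bs \<and> v = as @ y # x # bs)" (is "?L \<longleftrightarrow> ?R")
proof
  assume ?L
  then obtain i where i: "Suc i < length u" "v = u[i := u ! Suc i, Suc i := u ! i]"
    unfolding differ_by_adjacent_transposition_def by blast
  have u: "u = take i u @ u ! i # u ! Suc i # drop (Suc (Suc i)) u"
    using i(1) by (metis Cons_nth_drop_Suc Suc_lessD append_take_drop_id)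
  have "v = take i u @ u ! Suc i # u ! i # drop (Suc (Suc i)) u"
    unfolding i(2) using i(1)
    by (subst (1) u) (simp add: list_update_append nth_append)
  with u show ?R by blast
next
  assume ?R
  then obtain as x y bs where "u = as @ x # y # bs" "v = as @ y # x # bs" by blast
  then show ?L
    unfolding differ_by_adjacent_transposition_def
    by (intro exI[of _ "length as"]) (simp add: list_update_append nth_append)
qed

lemma symp_differ_by_adjacent_transposition: "symp differ_by_adjacent_transposition"
  by (rule sympI) (auto simp: differ_by_adjacent_transposition_iff)

lemma differ_by_adjacent_transposition_append:
  assumes "differ_by_adjacent_transposition u v"
  shows "differ_by_adjacent_transposition (as @ u @ bs) (as @ v @ bs)"
  using assms unfolding differ_by_adjacent_transposition_iff
  by (metis append.assoc append_Cons)

lemma length_eq_if_differ_by_adjacent_transposition: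
  "differ_by_adjacent_transposition u v \<Longrightarrow> length u = length v"
  by (auto simp: differ_by_adjacent_transposition_def)

section \<open>Extending standard permutations\<close>

text \<open>One step of the recursion for \<open>perm_of_word\<close>, taken on permutations alone.
  It also makes sense from order 0 to order 1.\<close>

definition extend :: "nat \<Rightarrow> int list \<Rightarrow> nat \<Rightarrow> int list" where
  "extend n w p = insert_at p (int n) w @ [- int n]"

text \<open>Subsequences survive both insertion of letters and filtering, which handles extension
  and its inverse without position arithmetic.\<close>

lemma occurs_before_iff_subseq: "occurs_before w x y \<longleftrightarrow> subseq [x, y] w"
proof
  assume "occurs_before w x y"
  then obtain p q where "p < q" "q < length w" "w ! p = x" "w ! q = y"
    unfolding occurs_before_def by blast
  hence "x \<in> set (take q w)" "y \<in> set (drop q w)"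
    by (auto simp: in_set_conv_nth intro: exI[of _ p] exI[of _ 0])
  hence "subseq ([x] @ [y]) (take q w @ drop q w)"
    by (intro list_emb_append_mono) (simp_all add: subseq_singleton_left)
  thus "subseq [x, y] w" by simp
next
  assume "subseq [x, y] w"
  then obtain as bs where w: "w = as @ x # bs" "y \<in> set bs"
    by (auto dest!: list_emb_ConsD simp: subseq_singleton_left)
  then obtain q where "q < length bs" "bs ! q = y" by (auto simp: in_set_conv_nth)
  with w show "occurs_before w x y"
    unfolding occurs_before_def
    by (intro exI[of _ "length as"] exI[of _ "Suc (length as + q)"]) (simp add: nth_append)
qed

lemma length_standard_permutation:
  assumes "standard_permutation n w"
  shows "length w = 2 * n"
proof -
  have "length w = card ({1..int n} \<union> {- int n..-1})"
    using assms unfolding standard_permutation_def by (metis distinct_card)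
  also have "\<dots> = 2 * n" by (subst card_Un_disjoint) auto
  finally show ?thesis .
qed

text \<open>The letter \<open>int n\<close> occurs once before the final entry, so it separates
  prefix from suffix. The prefix length gives back the position, as the bounds keep
  \<open>p - 1\<close> from truncating at 0 and \<open>take\<close> from running past the
  end.\<close>

lemma extend_inject:
  assumes "extend n w p = extend n v q" "int n \<notin> set w" "int n \<notin> set v"
    "p \<in> {1..Suc (length w)}" "q \<in> {1..Suc (length v)}"
  shows "w = v \<and> p = q"
proof -
  have "take (p - 1) w @ int n # drop (p - 1) w = take (q - 1) v @ int n # drop (q - 1) v"
    using assms(1) by (simp add: extend_def insert_at_def)
  moreover have "int n \<notin> set (take (p - 1) w)" "int n \<notin> set (take (q - 1) v)"
    "int n \<notin> set (drop (p - 1) w)" "int n \<notin> set (drop (q - 1) v)"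
    using assms(2,3) by (auto dest: in_set_takeD in_set_dropD)
  ultimately have eq: "take (p - 1) w = take (q - 1) v" "drop (p - 1) w = drop (q - 1) v"
    by (auto simp: append_Cons_eq_iff)
  hence "w = v" by (metis append_take_drop_id)
  moreover have "p - 1 = q - 1"
    using arg_cong[OF eq(1), of length] assms(4,5) by auto
  ultimately show ?thesis using assms(4,5) by auto
qed

lemma successively_extend:
  "length w = k \<Longrightarrow> successively differ_by_adjacent_transposition (map (extend n w) [1..<Suc (Suc k)])"
proof -
  assume k: "length w = k"
  have "differ_by_adjacent_transposition (extend n w (Suc p)) (extend n w (Suc (Suc p)))"
    if "p < length w" for p
  proof -
    have "take (Suc p) w = take p w @ [w ! p]" "drop p w = w ! p # drop (Suc p) w"
      using that by (simp_all add: take_Suc_conv_app_nth Cons_nth_drop_Suc)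
    then show ?thesis
      \<comment> \<open>Moving the inserted letter one place right swaps it with
        \<open>w ! p\<close>.\<close>
      unfolding extend_def insert_at_def differ_by_adjacent_transposition_iff
      by (intro exI[of _ "take p w"] exI[of _ "int n"] exI[of _ "w ! p"]
            exI[of _ "drop (Suc p) w @ [- int n]"]) simp
  qed
  then show ?thesis
    using k by (auto simp: successively_iff_nth simp del: upt_Suc)
qed

text \<open>At either end the new letter does not separate the two swapped entries, so
  \<open>u\<close> and \<open>v\<close> remain contiguous blocks.\<close>

lemma differ_by_adjacent_transposition_extend:
  assumes "differ_by_adjacent_transposition u v" "p \<in> {1, Suc (length u)}"
  shows "differ_by_adjacent_transposition (extend n u p) (extend n v p)"
  using assms(2) differ_by_adjacent_transposition_append[OF assms(1), of "[int n]" "[- int n]"]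
    differ_by_adjacent_transposition_append[OF assms(1), of "[]" "[int n, - int n]"]
    length_eq_if_differ_by_adjacent_transposition[OF assms(1)]
  by (auto simp: extend_def insert_at_def)

lemma signed_interval_Suc:
  "{1..int (Suc n)} \<union> {- int (Suc n)..-1}
     = insert (int (Suc n)) (insert (- int (Suc n)) ({1..int n} \<union> {- int n..-1}))"
  by auto

text \<open>The old word is a subsequence of the new one, so old pairs keep their order; the final
  \<open>- ?N\<close> follows \<open>?N\<close> and comes last among the negatives.\<close>

lemma standard_permutation_extend:
  assumes "standard_permutation n w"
  shows "standard_permutation (Suc n) (extend (Suc n) w p)"
proof -
  let ?a = "take (p - 1) w" and ?b = "drop (p - 1) w" and ?N = "int (Suc n)"
  have v: "extend (Suc n) w p = ?a @ ?N # ?b @ [- ?N]" (is "?v = _")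
    by (simp add: extend_def insert_at_def)
  have w: "distinct w" "set w = {1..int n} \<union> {- int n..-1}"
    "\<And>i. i \<in> {1..int n} \<Longrightarrow> subseq [i, - i] w"
    "filter (\<lambda>x. x < 0) w = map (\<lambda>i. - int i) [1..<Suc n]"
    using assms by (auto simp: standard_permutation_def occurs_before_iff_subseq)
  have ab: "set ?a \<union> set ?b = set w" "distinct (?a @ ?b)"
    using w(1) by (simp_all flip: set_append del: distinct_append)
  have N: "?N \<notin> set ?a \<union> set ?b" "- ?N \<notin> set ?a \<union> set ?b"
    unfolding ab(1) w(2) by auto
  have "distinct ?v"
    using ab(2)[unfolded distinct_append] N unfolding v by auto
  moreover have "set ?v = {1..?N} \<union> {- ?N..-1}"
    unfolding signed_interval_Suc w(2)[symmetric] ab(1)[symmetric] v by auto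
  moreover have "subseq [i, - i] ?v" if "i \<in> {1..?N}" for i
  proof (cases "i = ?N")
    case True
    have "subseq ([] @ [?N] @ [] @ [- ?N]) (?a @ [?N] @ ?b @ [- ?N])"
      by (intro list_emb_append_mono) simp_all
    then show ?thesis using True v by simp
  next
    case False
    hence "subseq [i, - i] w" using w(3) that by simp
    also have "subseq (?a @ [] @ ?b @ []) (?a @ [?N] @ ?b @ [- ?N])"
      by (intro list_emb_append_mono) simp_all
    hence "subseq w ?v" by (simp add: v)
    finally show ?thesis .
  qed
  moreover have "filter (\<lambda>x. x < 0) ?v = map (\<lambda>i. - int i) [1..<Suc (Suc n)]"
  proof -
    have "filter (\<lambda>x. x < 0) ?v = filter (\<lambda>x. x < 0) (?a @ ?b) @ [- ?N]"
      unfolding v filter_append by simp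
    then show ?thesis unfolding append_take_drop_id w(4) by simp
  qed
  ultimately show ?thesis
    by (simp add: standard_permutation_def occurs_before_iff_subseq)
qed

lemma standard_permutation_Suc_obtain:
  assumes "standard_permutation (Suc n) v"
  obtains w p where "standard_permutation n w" "p \<in> {1..2 * n + 1}" "v = extend (Suc n) w p"
proof -
  let ?N = "int (Suc n)"
  have v: "distinct v" "set v = {1..?N} \<union> {- ?N..-1}"
    "\<And>i. i \<in> {1..?N} \<Longrightarrow> subseq [i, - i] v"
    "filter (\<lambda>x. x < 0) v = map (\<lambda>i. - int i) [1..<Suc (Suc n)]"
    using assms by (auto simp: standard_permutation_def occurs_before_iff_subseq)
  have "v \<noteq> []" using v(2) by auto
  then obtain u l where u: "v = u @ [l]" by (metis rev_exhaust)
  \<comment> \<open>A positive last entry would need its negative after it, but by distinctness it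
    occurs only at the end.\<close>
  have "l < 0"
  proof (rule ccontr)
    assume "\<not> l < 0"
    moreover have "l \<in> {1..?N} \<union> {- ?N..-1}" unfolding v(2)[symmetric] u by simp
    ultimately have "l \<in> {1..?N}" by auto
    hence "occurs_before v l (- l)" using v(3) by (simp add: occurs_before_iff_subseq)
    then obtain p q where pq: "p < q" "q < length v" "v ! p = l"
      unfolding occurs_before_def by blast
    moreover have "v ! length u = l" "length v = Suc (length u)" using u by auto
    ultimately have "p = length u"
      using v(1) nth_eq_iff_index_eq[of v p "length u"] by auto
    with pq \<open>length v = Suc (length u)\<close> show False by simp
  qed
  \<comment> \<open>Being negative, \<open>l\<close> is also the last of the filtered negatives,
    whose order is prescribed.\<close>
  hence l: "l = - ?N" and neg_u: "filter (\<lambda>x. x < 0) u = map (\<lambda>i. - int i) [1..<Suc n]"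
    using v(4) by (simp_all add: u)
  have "?N \<in> set v" using v(2) by simp
  hence "?N \<in> set u" using u l by simp
  then obtain as bs where ab: "u = as @ ?N # bs" by (meson split_list)
  define w where "w = as @ bs"
  have v_eq: "v = as @ ?N # bs @ [- ?N]" using u l ab by simp
  have dw: "distinct w" "?N \<notin> set w" "- ?N \<notin> set w"
    using v(1) unfolding v_eq w_def by auto
  have "set w = set v - {?N, - ?N}"
    using dw(2,3) unfolding v_eq w_def by auto
  also have "\<dots> = {1..int n} \<union> {- int n..-1}"
    unfolding v(2) by auto
  finally have sw: "set w = {1..int n} \<union> {- int n..-1}" .
  \<comment> \<open>Writing the deletion of both letters as a filter gives the order of the
    remaining pairs by \<open>subseq_filter\<close>.\<close>
  have "filter (\<lambda>x. x \<noteq> ?N \<and> x \<noteq> - ?N) w = w"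
    using dw by (auto simp: filter_id_conv)
  hence fw: "filter (\<lambda>x. x \<noteq> ?N \<and> x \<noteq> - ?N) v = w"
    by (simp add: v_eq w_def)
  have "subseq [i, - i] w" if "i \<in> {1..int n}" for i
  proof -
    have "subseq (filter (\<lambda>x. x \<noteq> ?N \<and> x \<noteq> - ?N) [i, - i]) (filter (\<lambda>x. x \<noteq> ?N \<and> x \<noteq> - ?N) v)"
      using v(3) that by (intro subseq_filter) auto
    then show ?thesis using that fw by simp
  qed
  moreover have "filter (\<lambda>x. x < 0) w = map (\<lambda>i. - int i) [1..<Suc n]"
    using neg_u by (simp add: ab w_def)
  ultimately have sp: "standard_permutation n w"
    using dw sw by (simp add: standard_permutation_def occurs_before_iff_subseq)
  moreover have "Suc (length as) \<in> {1..2 * n + 1}"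
    using length_standard_permutation[OF sp] by (simp add: w_def)
  moreover have "v = extend (Suc n) w (Suc (length as))"
    by (simp add: v_eq w_def extend_def insert_at_def)
  ultimately show thesis by (rule that)
qed

text \<open>Order 0 has only the empty word, and there only position 1 is available.\<close>

lemma standard_permutation_1_iff: "standard_permutation 1 w \<longleftrightarrow> w = [1, - 1]"
proof
  assume "standard_permutation 1 w"
  then obtain v p where v: "standard_permutation 0 v" "p \<in> {1..1}" "w = extend 1 v p"
    by (metis One_nat_def standard_permutation_Suc_obtain mult_0_right add_0)
  from v(1) have "v = []" by (simp add: standard_permutation_def)
  with v show "w = [1, - 1]" by (simp add: extend_def insert_at_def)
next
  assume w: "w = [1, - 1]"
  have "standard_permutation 0 []" by (simp add: standard_permutation_def)
  from standard_permutation_extend[OF this, of 1] w show "standard_permutation 1 w"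
    by (simp add: extend_def insert_at_def)
qed

section \<open>The Gray code\<close>

lemma gray_words_Suc_Suc:
  "gray_words (Suc (Suc k)) =
     boustrophedon (\<lambda>w x. w @ [x]) [1..<2 * Suc (Suc k)] True (gray_words (Suc k))"
  using concat_map_parity_eq_boustrophedon[of "\<lambda>w x. w @ [x]" "gray_words (Suc k)" 1]
  by (simp add: Let_def del: upt_Suc)

text \<open>\<open>perm_of_word\<close> inserts the length of its argument, so this fixes which
  letter is new.\<close>

lemma length_gray_words: "w \<in> set (gray_words n) \<Longrightarrow> length w = n"
proof (induction n arbitrary: w rule: gray_words.induct)
  case (3 k)
  then show ?case
    by (auto simp: gray_words_Suc_Suc set_boustrophedon simp del: gray_words.simps)
qed auto

lemma perm_of_word_snoc:
  "length w = Suc k \<Longrightarrow> perm_of_word (w @ [x]) = extend (Suc (Suc k)) (perm_of_word w) x"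
  by (subst perm_of_word.simps) (auto simp: extend_def)

lemma map_perm_of_word_gray_words_Suc_Suc:
  "map perm_of_word (gray_words (Suc (Suc k))) =
     boustrophedon (extend (Suc (Suc k))) [1..<2 * Suc (Suc k)] True
       (map perm_of_word (gray_words (Suc k)))"
  unfolding gray_words_Suc_Suc
  by (rule map_boustrophedon) (auto intro: perm_of_word_snoc length_gray_words)

theorem theorem4p1:
  fixes n :: nat
  assumes "n \<ge> 1"
  shows "adjacent_transposition_gray_code {w. standard_permutation n w}
           (map perm_of_word (gray_words n))"
proof -
  \<comment> \<open>The adjacency condition is put as \<open>successively\<close>, the form in which
    the product lemma consumes and returns it.\<close>
  have "set (map perm_of_word (gray_words n)) = {w. standard_permutation n w} \<and>
      distinct (map perm_of_word (gray_words n)) \<and>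
      successively differ_by_adjacent_transposition (map perm_of_word (gray_words n))"
    using assms
  proof (induction n rule: nat_induct_at_least)
    case base
    show ?case
      by (simp add: standard_permutation_1_iff[simplified] perm_of_word.simps[of "[Suc 0]"])
  next
    case (Suc n)
    let ?ps = "map perm_of_word (gray_words n)" and ?xs = "[1..<2 * Suc n]"
    have ps: "set ?ps = {w. standard_permutation n w}" "distinct ?ps"
      "successively differ_by_adjacent_transposition ?ps"
      using Suc.IH by auto
    have xs: "?xs = [1..<Suc (Suc (2 * n))]" by simp
    have step: "map perm_of_word (gray_words (Suc n)) = boustrophedon (extend (Suc n)) ?xs True ?ps"
      using Suc.hyps map_perm_of_word_gray_words_Suc_Suc[of "n - 1"] by simp
    have len: "length w = 2 * n" if "w \<in> set ?ps" for w
      using that ps(1) length_standard_permutation by blast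
    have "set (boustrophedon (extend (Suc n)) ?xs True ?ps) = {w. standard_permutation (Suc n) w}"
      unfolding set_boustrophedon ps(1)
      by (auto intro: standard_permutation_extend elim!: standard_permutation_Suc_obtain
        simp del: upt_Suc)
    moreover have "distinct (boustrophedon (extend (Suc n)) ?xs True ?ps)"
    proof (rule distinct_boustrophedon[OF ps(2)])
      \<comment> \<open>The new letter is absent from every shorter permutation, as
        \<open>extend_inject\<close> requires.\<close>
      have "int (Suc n) \<notin> set w" if "w \<in> set ?ps" for w
        using that unfolding ps(1) by (auto simp: standard_permutation_def)
      then show "inj_on (\<lambda>(w, x). extend (Suc n) w x) (set ?ps \<times> set ?xs)"
        using len by (intro inj_onI) (auto dest!: extend_inject simp del: upt_Suc)
    qed simp
    moreover have "successively differ_by_adjacent_transposition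
        (boustrophedon (extend (Suc n)) ?xs True ?ps)"
    proof (rule successively_boustrophedon[OF symp_differ_by_adjacent_transposition _ ps(3)])
      show "successively differ_by_adjacent_transposition (map (extend (Suc n) w) ?xs)"
        if "w \<in> set ?ps" for w
        using successively_extend[OF len[OF that]] unfolding xs .
      show "differ_by_adjacent_transposition (extend (Suc n) u x) (extend (Suc n) v x)"
        if "differ_by_adjacent_transposition u v" "u \<in> set ?ps" "x \<in> {hd ?xs, last ?xs}" for u v x
      proof (rule differ_by_adjacent_transposition_extend[OF that(1)])
        \<comment> \<open>As \<open>u\<close> has length \<open>2 * n\<close>, the ends of
          \<open>?xs\<close> are exactly the two extreme insertion positions.\<close>
        have "hd ?xs = 1" "last ?xs = Suc (2 * n)" by simp_all
        with that(3) show "x \<in> {1, Suc (length u)}" unfolding len[OF that(2)] by simp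
      qed
    qed simp
    ultimately show ?case unfolding step by blast
  qed
  then show ?thesis
    by (simp add: adjacent_transposition_gray_code_def successively_iff_nth)
qed

end
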